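(* Let $J$ be a free ideal on a set $S$ with $S\notin\langle J\rangle$, and let $\lambda$ be a cardinal such that: 1. $bu(\langle J\rangle,\subset)=\aleph_2$; 2. $add(\langle J\rangle,\subset)=\aleph_1$; 3. $cof(\langle J\rangle,\subset)=\lambda$; 4. the ideal $[\lambda]^{<\aleph_0}$ has the coherent decomposition property. Then player TWO has a winning $3$-tactic in $VSG(J)$.
   Context: The symbol $\subset$ means "is a proper subset of". A free ideal $J$ on $S$ is an ideal of subsets of $S$ with $\bigcup J=S$; $\langle J\rangle$ is its $\sigma$-completion, i.e. the collection of all unions of countably many members of $J$. For a partially ordered set $(P,<)$ without maximum element: $add(P,<)$ is the least cardinality of a subset of $P$ with no upper bound in $P$; $cof(P,<)$ is the least cardinality of a cofinal subset $X\subseteq P$ (for each $p\in P$ there is $x\in X$ with $p\le x$); $burst(P,<)$ is the smallest cardinal exceeding the cardinality of each bounded subset of $P$; and $bu(P,<)=\min\{burst(Q,<):Q\text{ a cofinal subset of }P\}$. Coherent decomposition property of a free ideal $I$: there is a cofinal subset $\mathcal{B}$ of $(\langle I\rangle,\subset)$ and for each $B\in\mathcal{B}$ a sequence $(B^n:n<\omega)$ of elements of $I$ with $B=\bigcup_n B^n$, $B^n\subseteq B^m$ for $n<m$, and such that for all $A\subset B$ in $\mathcal{B}$ there is $m$ with $A^n\subseteq B^n$ for all $n\ge m$. For $I=[\lambda]^{<\aleph_0}$ (the finite subsets of $\lambda$), $\langle I\rangle=[\lambda]^{\le\aleph_0}$. Game $VSG(J)$: in inning $n$ ($n=1,2,\dots$)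 ONE plays $O_n\in\langle J\rangle$ and TWO responds with a pair $(T_n,S_n)\in J\times\langle J\rangle$; ONE must satisfy $O_n\cup T_n\cup S_n\subseteq O_{n+1}$ for all $n$. TWO wins if $\bigcup_n O_n=\bigcup_n T_n$. A $k$-tactic for TWO is a function $F$ assigning an element of $J\times\langle J\rangle$ to each sequence of length at most $k$ (and at least $1$) of possible successive moves of ONE; it is winning if TWO wins every play with $(T_j,S_j)=F(O_1,\dots,O_j)$ for $j\le k$ and $(T_{n+k},S_{n+k})=F(O_{n+1},\dots,O_{n+k})$ for all $n\ge 1$. *)

theory Defs
  imports "HOL-Library.Countable_Set"
begin

unbundle cardinal_syntax

text \<open>
  Cardinals are the cardinal orders of the BNF library. Each characteristic is a predicate
  "the value for \<open>P\<close> is \<open>\<kappa>\<close>", true of no \<open>\<kappa>\<close> when the family being minimised over is empty;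
  since \<open>=o\<close> and \<open>\<le>o\<close> compare across types, \<open>\<kappa>\<close> may live on any type.
  A poset is a subset \<open>P\<close> of a type of class order: a family of sets thus carries \<open>\<subset>\<close> as its
  strict order and \<open>\<subseteq>\<close> as its reflexive closure.
\<close>

definition least_cardinality :: "'a set set \<Rightarrow> 'k rel \<Rightarrow> bool" where
  "least_cardinality \<X> \<kappa> \<longleftrightarrow> (\<exists>X\<in>\<X>. |X| =o \<kappa>) \<and> (\<forall>X\<in>\<X>. \<kappa> \<le>o |X| )"

definition bounded_in :: "'a::order set \<Rightarrow> 'a set \<Rightarrow> bool" where
  "bounded_in P X \<longleftrightarrow> X \<subseteq> P \<and> (\<exists>u\<in>P. \<forall>x\<in>X. x \<le> u)"

definition cofinal_in :: "'a::order set \<Rightarrow> 'a set \<Rightarrow> bool" where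
  "cofinal_in P X \<longleftrightarrow> X \<subseteq> P \<and> (\<forall>p\<in>P. \<exists>x\<in>X. p \<le> x)"

definition is_add :: "'a::order set \<Rightarrow> 'k rel \<Rightarrow> bool" where
  "is_add P \<kappa> \<longleftrightarrow> least_cardinality {X. X \<subseteq> P \<and> \<not> bounded_in P X} \<kappa>"

definition is_cof :: "'a::order set \<Rightarrow> 'k rel \<Rightarrow> bool" where
  "is_cof P \<kappa> \<longleftrightarrow> least_cardinality {X. cofinal_in P X} \<kappa>"

definition exceeds_bounded :: "'a::order set \<Rightarrow> 'k rel \<Rightarrow> bool" where
  "exceeds_bounded P \<kappa> \<longleftrightarrow> Card_order \<kappa> \<and> (\<forall>X. bounded_in P X \<longrightarrow> |X| <o \<kappa>)"

text \<open>
  In the next two definitions \<open>\<kappa>'\<close> ranges over cardinals on the type of \<open>\<kappa>\<close>. This is no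
  restriction, because every cardinal below \<open>\<kappa>\<close> has a copy on that type; the lemmas
  \<open>is_burst_least\<close> and \<open>is_bu_least\<close> below give minimality over all types.
\<close>

definition is_burst :: "'a::order set \<Rightarrow> 'k rel \<Rightarrow> bool" where
  "is_burst P \<kappa> \<longleftrightarrow> exceeds_bounded P \<kappa> \<and>
     (\<forall>\<kappa>' :: 'k rel. exceeds_bounded P \<kappa>' \<longrightarrow> \<kappa> \<le>o \<kappa>')"

definition is_bu :: "'a::order set \<Rightarrow> 'k rel \<Rightarrow> bool" where
  "is_bu P \<kappa> \<longleftrightarrow> (\<exists>Q. cofinal_in P Q \<and> is_burst Q \<kappa>) \<and>
     (\<forall>Q (\<kappa>' :: 'k rel). cofinal_in P Q \<and> is_burst Q \<kappa>' \<longrightarrow> \<kappa> \<le>o \<kappa>')"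

lemma exceeds_bounded_ordIso:
  assumes "exceeds_bounded P \<kappa>" "\<kappa> =o \<kappa>'"
  shows "exceeds_bounded P \<kappa>'"
proof -
  have "Card_order \<kappa>'"
    using assms Card_order_ordIso2 unfolding exceeds_bounded_def by blast
  moreover have "|X| <o \<kappa>'" if "bounded_in P X" for X
    using assms(1) that unfolding exceeds_bounded_def
    by (intro ordLess_ordIso_trans[OF _ assms(2)]) simp
  ultimately show ?thesis
    unfolding exceeds_bounded_def by simp
qed

lemma is_burst_least:
  fixes \<kappa> :: "'k rel" and \<kappa>' :: "'l rel"
  assumes "is_burst P \<kappa>" "exceeds_bounded P \<kappa>'"
  shows "\<kappa> \<le>o \<kappa>'"
proof (rule ccontr)
  assume n: "\<not> \<kappa> \<le>o \<kappa>'"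
  have "Well_order \<kappa>" "Well_order \<kappa>'"
    using assms unfolding is_burst_def exceeds_bounded_def card_order_on_def by auto
  with n have "\<kappa>' <o \<kappa>" by (simp add: not_ordLeq_iff_ordLess)
  then obtain p :: "'k rel" where p: "\<kappa>' =o p" "p <o \<kappa>"
    using internalize_ordLess[of \<kappa>' \<kappa>] by auto
  have "\<kappa> \<le>o p"
    using assms(1) exceeds_bounded_ordIso[OF assms(2) p(1)] unfolding is_burst_def by simp
  with p(2) show False using not_ordLess_ordLeq[of p \<kappa>] by simp
qed

lemma is_bu_least:
  fixes \<kappa> :: "'k rel" and \<kappa>' :: "'l rel"
  assumes "is_bu P \<kappa>" "cofinal_in P Q" "is_burst Q \<kappa>'"
  shows "\<kappa> \<le>o \<kappa>'"
proof (rule ccontr)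
  assume n: "\<not> \<kappa> \<le>o \<kappa>'"
  have "Well_order \<kappa>" "Well_order \<kappa>'"
    using assms unfolding is_bu_def is_burst_def exceeds_bounded_def card_order_on_def by auto
  with n have "\<kappa>' <o \<kappa>" by (simp add: not_ordLeq_iff_ordLess)
  then obtain p :: "'k rel" where p: "\<kappa>' =o p" "p <o \<kappa>"
    using internalize_ordLess[of \<kappa>' \<kappa>] by auto
  have "exceeds_bounded Q p"
    using assms(3) unfolding is_burst_def
    by (intro exceeds_bounded_ordIso[OF _ p(1)]) simp
  moreover have "p \<le>o \<kappa>''" if "exceeds_bounded Q \<kappa>''" for \<kappa>'' :: "'k rel"
    by (rule ordIso_ordLeq_trans[OF ordIso_symmetric[OF p(1)] is_burst_least[OF assms(3) that]])
  ultimately have "is_burst Q p" unfolding is_burst_def by simp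
  with assms(1,2) have "\<kappa> \<le>o p" unfolding is_bu_def by blast
  with p(2) show False using not_ordLess_ordLeq[of p \<kappa>] by simp
qed

definition free_ideal :: "'a set \<Rightarrow> 'a set set \<Rightarrow> bool" where
  "free_ideal S J \<longleftrightarrow> J \<subseteq> Pow S \<and> {} \<in> J \<and>
     (\<forall>A B. B \<in> J \<and> A \<subseteq> B \<longrightarrow> A \<in> J) \<and>
     (\<forall>A B. A \<in> J \<and> B \<in> J \<longrightarrow> A \<union> B \<in> J) \<and> \<Union>J = S"

definition sigma_completion :: "'a set set \<Rightarrow> 'a set set" where
  "sigma_completion J = {\<Union>\<C> | \<C>. countable \<C> \<and> \<C> \<subseteq> J}"

lemma free_ideal_Fpow: "free_ideal L (Fpow L)"
  unfolding free_ideal_def Fpow_def by (auto intro: finite_subset)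

lemma sigma_completion_Fpow: "sigma_completion (Fpow L) = {A. A \<subseteq> L \<and> countable A}"
proof (intro set_eqI iffI)
  fix A assume "A \<in> sigma_completion (Fpow L)"
  then show "A \<in> {A. A \<subseteq> L \<and> countable A}"
    unfolding sigma_completion_def Fpow_def
    by (auto intro!: countable_UN[where A = "\<lambda>X. X", simplified image_ident] intro: countable_finite)
next
  fix A assume A: "A \<in> {A. A \<subseteq> L \<and> countable A}"
  have "A = \<Union>((\<lambda>x. {x}) ` A)" by simp
  moreover have "countable ((\<lambda>x. {x}) ` A)" "(\<lambda>x. {x}) ` A \<subseteq> Fpow L"
    using A by (auto simp: Fpow_def)
  ultimately show "A \<in> sigma_completion (Fpow L)"
    unfolding sigma_completion_def by blast
qed

definition coherent_decomposition :: "'a set set \<Rightarrow> bool" where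
  "coherent_decomposition I \<longleftrightarrow>
     (\<exists>\<B> (D :: 'a set \<Rightarrow> nat \<Rightarrow> 'a set).
        cofinal_in (sigma_completion I) \<B> \<and>
        (\<forall>B\<in>\<B>. (\<forall>n. D B n \<in> I) \<and> B = (\<Union>n. D B n) \<and> (\<forall>n m. n < m \<longrightarrow> D B n \<subseteq> D B m)) \<and>
        (\<forall>A\<in>\<B>. \<forall>B\<in>\<B>. A \<subset> B \<longrightarrow> (\<exists>m. \<forall>n\<ge>m. D A n \<subseteq> D B n)))"

text \<open>
  Innings are numbered from 0: \<open>Om n\<close> is ONE's move and \<open>(T n, U n)\<close> is TWO's response in
  inning \<open>n + 1\<close> in the usual numbering, which starts at 1.
\<close>

definition VSG_play ::
    "'a set set \<Rightarrow> (nat \<Rightarrow> 'a set) \<Rightarrow> (nat \<Rightarrow> 'a set) \<Rightarrow> (nat \<Rightarrow> 'a set) \<Rightarrow> bool" where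
  "VSG_play J Om T U \<longleftrightarrow>
     (\<forall>n. Om n \<in> sigma_completion J \<and> T n \<in> J \<and> U n \<in> sigma_completion J \<and>
          Om n \<union> T n \<union> U n \<subseteq> Om (Suc n))"

definition VSG_TWO_wins :: "(nat \<Rightarrow> 'a set) \<Rightarrow> (nat \<Rightarrow> 'a set) \<Rightarrow> bool" where
  "VSG_TWO_wins Om T \<longleftrightarrow> (\<Union>n. Om n) = (\<Union>n. T n)"

text \<open>
  Successive moves of ONE form a \<open>\<subseteq>\<close>-increasing chain, so \<open>F\<close> only has to return legal
  responses on such sequences; its values on other lists are irrelevant.
\<close>

definition VSG_tactic_TWO ::
    "'a set set \<Rightarrow> nat \<Rightarrow> ('a set list \<Rightarrow> 'a set \<times> 'a set) \<Rightarrow> bool" where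
  "VSG_tactic_TWO J k F \<longleftrightarrow>
     (\<forall>xs. 1 \<le> length xs \<and> length xs \<le> k \<and> set xs \<subseteq> sigma_completion J \<and> sorted_wrt (\<subseteq>) xs
        \<longrightarrow> F xs \<in> J \<times> sigma_completion J)"

definition VSG_follows ::
    "nat \<Rightarrow> ('a set list \<Rightarrow> 'a set \<times> 'a set) \<Rightarrow>
     (nat \<Rightarrow> 'a set) \<Rightarrow> (nat \<Rightarrow> 'a set) \<Rightarrow> (nat \<Rightarrow> 'a set) \<Rightarrow> bool" where
  "VSG_follows k F Om T U \<longleftrightarrow>
     (\<forall>j<k. (T j, U j) = F (map Om [0..<Suc j])) \<and>
     (\<forall>n. (T (n + k), U (n + k)) = F (map Om [Suc n..<Suc (n + k)]))"

definition VSG_winning_tactic_TWO ::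
    "'a set set \<Rightarrow> nat \<Rightarrow> ('a set list \<Rightarrow> 'a set \<times> 'a set) \<Rightarrow> bool" where
  "VSG_winning_tactic_TWO J k F \<longleftrightarrow> VSG_tactic_TWO J k F \<and>
     (\<forall>Om T U. VSG_play J Om T U \<and> VSG_follows k F Om T U \<longrightarrow> VSG_TWO_wins Om T)"

end

theory Submission
  imports Defs "HOL-Library.Countable_Set_Type"
begin

text \<open>
  There is a cofinal \<open>Q\<close>, well-founded under \<open>\<subset>\<close> and of size at most \<open>\<lambda>\<close>, whose elements have at
  most \<open>\<aleph>\<^sub>1\<close> predecessors in \<open>Q\<close>. Recursion along \<open>Q\<close> assigns to each \<open>q\<close> an increasing
  \<open>\<omega>\<^sub>1\<close>-chain \<open>b q\<close> of countable sets from the coherent family, each a code for a set of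
  members of \<open>Q\<close> containing \<open>q\<close>, such that every entry of \<open>b p\<close> is included in the late entries
  of \<open>b q\<close> whenever \<open>p \<subseteq> q\<close>. An unbounded \<open>\<omega>\<^sub>1\<close>-sequence \<open>G\<close> in \<open>\<langle>J\<rangle>\<close> turns each move \<open>X\<close> of ONE
  into the countable ordinal \<open>\<rho> X\<close>, the least \<open>\<xi>\<close> with \<open>G \<xi> \<not>\<subseteq> X\<close>. Through the second
  component of the response TWO forces ONE's next move above a member of \<open>Q\<close> covering the last one,
  and its ordinal as high as desired; hence the codes \<open>b q\<^sub>n (\<rho> O\<^bsub>n+1\<^esub>)\<close> increase with \<open>n\<close>.

  TWO plays the union of the \<open>k\<close>-th pieces of the finitely many members of \<open>Q\<close> in the \<open>k\<close>-th
  piece of the current code. Three consecutive moves determine two consecutive codes, hence a \<open>k\<close>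
  beyond which their decompositions cohere, and this \<open>k\<close> is also made at least \<open>h \<xi> \<eta>\<close> for
  consecutive ordinals, where \<open>h\<close> is unbounded on every increasing path. At the stages at which \<open>k\<close>
  exceeds all earlier values, all the earlier decompositions cohere, so everything gets covered.
\<close>

section \<open>The first uncountable ordinal\<close>

text \<open>A type of class \<open>wellorder\<close> makes \<open>LEAST\<close>, order notation and
  well-founded recursion available for countable ordinals.\<close>

typedef omega1 = "Field (cardSuc natLeq)"
proof -
  have "\<not> finite (Field (cardSuc natLeq))"
    using cardSuc_finite[OF natLeq_Card_order] by (simp add: Field_natLeq)
  then show ?thesis
    by (metis ex_in_conv finite.emptyI)
qed

lemma Well_order_cardSuc_natLeq: "Well_order (cardSuc natLeq)"
  by (simp add: cardSuc_Card_order natLeq_Card_order card_order_on_well_order_on)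

instantiation omega1 :: wellorder
begin

definition less_eq_omega1 :: "omega1 \<Rightarrow> omega1 \<Rightarrow> bool" where
  "x \<le> y \<longleftrightarrow> (Rep_omega1 x, Rep_omega1 y) \<in> cardSuc natLeq"

definition less_omega1 :: "omega1 \<Rightarrow> omega1 \<Rightarrow> bool" where
  "(x :: omega1) < y \<longleftrightarrow> x \<le> y \<and> x \<noteq> y"

instance
proof
  interpret wo_rel "cardSuc natLeq"
    using Well_order_cardSuc_natLeq by (simp add: wo_rel_def)
  fix x y z :: omega1
  show le_refl: "x \<le> x"
    using REFL Rep_omega1[of x] by (simp add: less_eq_omega1_def refl_on_def)
  show antisym: "x = y" if "x \<le> y" "y \<le> x"
    using that ANTISYM Rep_omega1_inject[of x y] by (auto simp: less_eq_omega1_def antisym_def)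
  show "x < y \<longleftrightarrow> x \<le> y \<and> \<not> y \<le> x"
    using le_refl antisym by (auto simp: less_omega1_def)
  show "x \<le> z" if "x \<le> y" "y \<le> z"
    using that TRANS unfolding less_eq_omega1_def trans_def by blast
  show "x \<le> y \<or> y \<le> x"
    using TOTALS Rep_omega1[of x] Rep_omega1[of y] by (simp add: less_eq_omega1_def)
  have "wf (inv_image (cardSuc natLeq - Id) Rep_omega1)"
    using WF by (rule wf_inv_image)
  moreover have "inv_image (cardSuc natLeq - Id) Rep_omega1 = {(a, b). a < b}"
    by (auto simp: inv_image_def less_omega1_def less_eq_omega1_def Rep_omega1_inject)
  ultimately have wf: "wf {(a :: omega1, b). a < b}"
    by simp
  fix P :: "omega1 \<Rightarrow> bool" and a
  assume "\<And>x. (\<And>y. y < x \<Longrightarrow> P y) \<Longrightarrow> P x"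
  then show "P a"
    using wf_induct_rule[OF wf, of P a] by auto
qed

end

lemma card_of_omega1: "|UNIV :: omega1 set| =o cardSuc natLeq"
proof -
  have "bij_betw Rep_omega1 UNIV (Field (cardSuc natLeq))"
    using type_definition.Rep_range[OF type_definition_omega1]
    by (simp add: bij_betw_def inj_on_def Rep_omega1_inject)
  then have "|UNIV :: omega1 set| =o |Field (cardSuc natLeq)|"
    using card_of_ordIso by blast
  also have "|Field (cardSuc natLeq)| =o cardSuc natLeq"
    by (simp add: card_of_Field_ordIso cardSuc_Card_order natLeq_Card_order)
  finally show ?thesis .
qed

lemma uncountable_omega1: "uncountable (UNIV :: omega1 set)"
proof
  assume "countable (UNIV :: omega1 set)"
  then have "cardSuc natLeq \<le>o natLeq"
    unfolding countable_card_le_natLeq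
    using card_of_omega1 ordIso_symmetric ordIso_ordLeq_trans by blast
  then show False
    using cardSuc_greater[OF natLeq_Card_order] not_ordLess_ordLeq by blast
qed

lemma countable_ordLeq_omega1: "countable A \<Longrightarrow> |A| \<le>o |UNIV :: omega1 set|"
  unfolding countable_card_le_natLeq
  using ordLeq_transitive[OF _ ordLeq_ordIso_trans[OF cardSuc_ordLeq[OF natLeq_Card_order]
        ordIso_symmetric[OF card_of_omega1]]] .

lemma countable_lessThan_omega1: "countable {..< x :: omega1}"
proof -
  have "|underS (cardSuc natLeq) (Rep_omega1 x)| <o cardSuc natLeq"
    by (rule card_of_underS[OF cardSuc_Card_order[OF natLeq_Card_order] Rep_omega1])
  then have "countable (underS (cardSuc natLeq) (Rep_omega1 x))"
    unfolding countable_card_le_natLeq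
    by (rule iffD1[OF cardSuc_ordLeq_ordLess[OF natLeq_Card_order card_of_Card_order]])
  moreover have "Rep_omega1 ` {..<x} \<subseteq> underS (cardSuc natLeq) (Rep_omega1 x)"
    by (auto simp: underS_def less_omega1_def less_eq_omega1_def Rep_omega1_inject)
  moreover have "inj_on Rep_omega1 {..<x}"
    by (simp add: inj_on_def Rep_omega1_inject)
  ultimately show ?thesis
    by (meson countable_image_inj_on countable_subset)
qed

lemma countable_atMost_omega1: "countable {.. x :: omega1}"
proof -
  have "{..x} = insert x {..<x}"
    by auto
  then show ?thesis
    by (simp add: countable_lessThan_omega1)
qed

text \<open>Regularity of \<open>omega1\<close>: countably many countable initial segments cannot
  exhaust it, and any point outside them lies strictly above \<open>A\<close>.\<close>

lemma countable_omega1_bounded: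
  fixes A :: "omega1 set"
  assumes "countable A"
  shows "\<exists>d. \<forall>a\<in>A. a < d"
proof -
  have "countable (\<Union>a\<in>A. {..a})"
    using assms countable_atMost_omega1 by blast
  then obtain d where "d \<notin> (\<Union>a\<in>A. {..a})"
    using uncountable_omega1 by (metis UNIV_eq_I)
  then show ?thesis
    by (auto simp: not_le)
qed

text \<open>Transfinite recursion of length \<open>omega1\<close>. Only countably many values
  precede stage \<open>\<eta>\<close>, so the hypothesis applies to them; \<open>P \<eta>\<close>
  lets each stage meet a task of its own.\<close>

lemma omega1_sequence:
  assumes "\<And>A \<eta>. countable A \<Longrightarrow> A \<subseteq> X \<Longrightarrow> \<exists>y\<in>X. (\<forall>a\<in>A. R a y) \<and> P \<eta> y"
  shows "\<exists>f :: omega1 \<Rightarrow> 'x. \<forall>\<eta>. f \<eta> \<in> X \<and> P \<eta> (f \<eta>) \<and> (\<forall>\<xi><\<eta>. R (f \<xi>) (f \<eta>))"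
proof (rule dependent_wf_choice[OF wf[where 'a = omega1]])
  fix f :: "omega1 \<Rightarrow> 'x" and \<eta>
  assume "\<And>\<xi>. (\<xi>, \<eta>) \<in> {(x, y). x < y} \<Longrightarrow>
    f \<xi> \<in> X \<and> P \<xi> (f \<xi>) \<and> (\<forall>\<zeta><\<xi>. R (f \<zeta>) (f \<xi>))"
  then have "f ` {..<\<eta>} \<subseteq> X"
    by auto
  moreover have "countable (f ` {..<\<eta>})"
    by (simp add: countable_lessThan_omega1)
  ultimately obtain y where "y \<in> X" "\<forall>a\<in>f ` {..<\<eta>}. R a y" "P \<eta> y"
    using assms by meson
  then show "\<exists>y. y \<in> X \<and> P \<eta> y \<and> (\<forall>\<xi><\<eta>. R (f \<xi>) y)"
    by auto
qed auto

section \<open>Unbounded colourings of increasing paths\<close>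

text \<open>A diagonal argument: enumerate \<open>A\<close> and let \<open>y\<close> grow so slowly
  that at \<open>k\<close> it stays below the first \<open>y k\<close> functions.\<close>

lemma eventually_dominated_unbounded:
  fixes A :: "(nat \<Rightarrow> nat) set"
  assumes "countable A" and lim: "\<And>a m. a \<in> A \<Longrightarrow> \<exists>K. \<forall>k\<ge>K. m \<le> a k"
  shows "\<exists>y. (\<forall>m. \<exists>K. \<forall>k\<ge>K. m \<le> y k) \<and> (\<forall>a\<in>A. \<exists>K. \<forall>k\<ge>K. y k < a k)"
proof (cases "A = {}")
  case True
  then show ?thesis by (auto intro!: exI[of _ "\<lambda>k. k"])
next
  case False
  define a where "a = from_nat_into A"
  have aA: "a i \<in> A" and A: "A = range a" for i
    unfolding a_def using False assms(1) from_nat_into range_from_nat_into by metis+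
  define M where "M k = {m. m \<le> k \<and> (\<forall>i<m. m < a i k)}" for k
  define y where "y k = Max (M k)" for k
  have fin: "finite (M k)" for k
    unfolding M_def by auto
  have "0 \<in> M k" for k
    unfolding M_def by auto
  then have yM: "y k \<in> M k" for k
    unfolding y_def using Max_in[OF fin] by blast
  have unb: "\<exists>K. \<forall>k\<ge>K. m \<le> y k" for m
  proof -
    have "\<forall>i. \<exists>K. \<forall>k\<ge>K. Suc m \<le> a i k"
      using lim aA by blast
    then obtain K where K: "\<And>i k. K i \<le> k \<Longrightarrow> Suc m \<le> a i k"
      by metis
    define L where "L = Max (insert m (K ` {..<m}))"
    have "m \<le> y k" if "L \<le> k" for k
    proof -
      have "m \<le> k" "\<forall>i<m. K i \<le> k"
        using that unfolding L_def by auto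
      then have "m \<in> M k"
        using K unfolding M_def by (auto simp: less_eq_Suc_le)
      then show ?thesis
        unfolding y_def using Max_ge[OF fin] by blast
    qed
    then show ?thesis by blast
  qed
  \<comment> \<open>Once \<open>y k\<close> exceeds \<open>i\<close>, the function
    \<open>a i\<close> is among those that membership of \<open>y k\<close> in \<open>M k\<close>
    compares.\<close>
  have "\<exists>K. \<forall>k\<ge>K. y k < a i k" for i
  proof -
    obtain K where "\<forall>k\<ge>K. Suc i \<le> y k"
      using unb by blast
    then have "\<forall>k\<ge>K. y k < a i k"
      using yM unfolding M_def by (auto simp: Suc_le_eq)
    then show ?thesis by blast
  qed
  then show ?thesis
    using unb A by blast
qed

text \<open>Along a path on which the colours stay below \<open>N\<close>, the values at \<open>N\<close> of an
  eventually decreasing \<open>\<omega>\<^sub>1\<close>-sequence of functions would descend forever.\<close>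

lemma omega1_path_colouring:
  "\<exists>h :: omega1 \<Rightarrow> omega1 \<Rightarrow> nat. \<forall>x :: nat \<Rightarrow> omega1. (\<forall>n. x n < x (Suc n)) \<longrightarrow>
     (\<forall>N. \<exists>n. N \<le> h (x n) (x (Suc n)))"
proof -
  let ?X = "{y :: nat \<Rightarrow> nat. \<forall>m. \<exists>K. \<forall>k\<ge>K. m \<le> y k}"
  let ?R = "\<lambda>a y. \<exists>K :: nat. \<forall>k\<ge>K. y k < (a k :: nat)"
  have "\<exists>y\<in>?X. (\<forall>a\<in>A. ?R a y) \<and> True" if "countable A" "A \<subseteq> ?X" for A
    using eventually_dominated_unbounded[OF that(1)] that(2) by blast
  from omega1_sequence[where X = ?X and R = ?R and P = "\<lambda>_ _. True", OF this]
  obtain r :: "omega1 \<Rightarrow> nat \<Rightarrow> nat" where r: "\<And>\<xi> \<eta>. \<xi> < \<eta> \<Longrightarrow> ?R (r \<xi>) (r \<eta>)"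
    by blast
  \<comment> \<open>The colour of a pair is the place from which the later function stays below the
    earlier one.\<close>
  define h where "h \<xi> \<eta> = (LEAST K. \<forall>k\<ge>K. r \<eta> k < r \<xi> k)" for \<xi> \<eta>
  have h: "r \<eta> k < r \<xi> k" if "\<xi> < \<eta>" "h \<xi> \<eta> \<le> k" for \<xi> \<eta> k
    using LeastI_ex[OF r[OF that(1)]] that(2) unfolding h_def by blast
  have "\<exists>n. N \<le> h (x n) (x (Suc n))" if x: "\<And>n. x n < x (Suc n)" for x :: "nat \<Rightarrow> omega1" and N
  proof (rule ccontr)
    assume "\<not> ?thesis"
    then have "h (x n) (x (Suc n)) \<le> N" for n
      by (meson nle_le)
    then have "r (x (Suc n)) N < r (x n) N" for n
      using h x by blast
    then show False
      using wf_no_infinite_down_chainE[OF wf, of "\<lambda>n. r (x n) N"] by auto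
  qed
  then show ?thesis by blast
qed

section \<open>Thin well-founded cofinal families\<close>

text \<open>Fix any well-order \<open>r\<close> of the type and keep the members of \<open>Q\<close>
  that lie below no \<open>r\<close>-earlier member. The \<open>r\<close>-least member of
  \<open>Q\<close> above a given point is kept, which preserves cofinality.\<close>

lemma cofinal_in_wf_subset:
  fixes P Q :: "'p::order set"
  assumes "cofinal_in P Q"
  shows "\<exists>Q'\<subseteq>Q. cofinal_in P Q' \<and> wf {(p, q). p \<in> Q' \<and> q \<in> Q' \<and> p < q}"
proof -
  obtain r :: "'p rel" where r: "Well_order r" "Field r = UNIV"
    using well_ordering by (elim exE conjE) (rule that)
  have wf: "wf (r - Id)" and tot: "\<And>p q. p \<noteq> q \<Longrightarrow> (p, q) \<in> r \<or> (q, p) \<in> r"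
    using r unfolding well_order_on_def linear_order_on_def total_on_def by simp_all
  define Q' where "Q' = {q \<in> Q. \<forall>p\<in>Q. (p, q) \<in> r - Id \<longrightarrow> \<not> q \<le> p}"
  have "\<exists>x\<in>Q'. p \<le> x" if "p \<in> P" for p
  proof -
    obtain x where "x \<in> {q\<in>Q. p \<le> q}"
      using assms \<open>p \<in> P\<close> unfolding cofinal_in_def by blast
    then obtain z where z: "z \<in> {q\<in>Q. p \<le> q}"
      and min: "\<And>y. (y, z) \<in> r - Id \<Longrightarrow> y \<notin> {q\<in>Q. p \<le> q}"
      by (rule wfE_min[OF wf]) (rule that)
    have "\<not> z \<le> y" if "y \<in> Q" "(y, z) \<in> r - Id" for y
    proof
      assume "z \<le> y"
      with z have "p \<le> y"
        using order_trans[of p z y] by simp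
      with min[OF that(2)] that(1) show False
        by simp
    qed
    with z have "z \<in> Q'"
      unfolding Q'_def by simp
    then show ?thesis using z by blast
  qed
  moreover have "Q' \<subseteq> Q"
    unfolding Q'_def by blast
  \<comment> \<open>If \<open>q\<close> came \<open>r\<close>-before \<open>p\<close>, then
    \<open>p\<close> would lie below an \<open>r\<close>-earlier member of \<open>Q\<close> and
    would not have been kept.\<close>
  moreover have "{(p, q). p \<in> Q' \<and> q \<in> Q' \<and> p < q} \<subseteq> r - Id"
    using tot unfolding Q'_def by (auto simp: less_le)
  moreover have "wf {(p, q). p \<in> Q' \<and> q \<in> Q' \<and> p < q}"
    using wf by (rule wf_subset) fact
  ultimately show ?thesis
    using assms unfolding cofinal_in_def by (intro exI[of _ Q']) auto
qed

text \<open>A cofinal family of least size is pushed upwards into one witnessing \<open>bu\<close>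
  and then thinned to a well-founded one. The predecessors of \<open>q\<close> stay bounded by
  \<open>q\<close> in the witness for \<open>bu\<close>, so there are fewer than
  \<open>\<aleph>\<^sub>2\<close> of them.\<close>

lemma thin_cofinal_subset:
  fixes P :: "'p::order set"
  assumes bu: "is_bu P (cardSuc (cardSuc natLeq))" and cof: "is_cof P lam"
  shows "\<exists>Q. cofinal_in P Q \<and> |Q| \<le>o lam \<and> wf {(p, q). p \<in> Q \<and> q \<in> Q \<and> p < q} \<and>
    (\<forall>q\<in>Q. |{p \<in> Q. p < q}| \<le>o |UNIV :: omega1 set| )"
proof -
  obtain Q where Q: "cofinal_in P Q" "exceeds_bounded Q (cardSuc (cardSuc natLeq))"
    using bu unfolding is_bu_def is_burst_def by blast
  obtain X where X: "cofinal_in P X" "|X| =o lam"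
    using cof unfolding is_cof_def least_cardinality_def by blast
  have "\<forall>x\<in>X. \<exists>q. q \<in> Q \<and> x \<le> q"
    using Q X unfolding cofinal_in_def by blast
  from bchoice[OF this] obtain s where s: "\<And>x. x \<in> X \<Longrightarrow> s x \<in> Q \<and> x \<le> s x"
    by blast
  have "cofinal_in P (s ` X)"
    unfolding cofinal_in_def
  proof (intro conjI ballI)
    show "s ` X \<subseteq> P"
      using Q(1) s unfolding cofinal_in_def by blast
    fix p assume "p \<in> P"
    then obtain x where "x \<in> X" "p \<le> x"
      using X(1) unfolding cofinal_in_def by blast
    then show "\<exists>y\<in>s ` X. p \<le> y"
      using s[of x] order_trans[of p x "s x"] by blast
  qed
  then obtain Q' where Q': "Q' \<subseteq> s ` X" "cofinal_in P Q'"
    "wf {(p, q). p \<in> Q' \<and> q \<in> Q' \<and> p < q}"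
    using cofinal_in_wf_subset by blast
  have "|Q'| \<le>o |s ` X|"
    using Q'(1) by (rule card_of_mono1)
  then have "|Q'| \<le>o lam"
    by (rule ordLeq_ordIso_trans[OF ordLeq_transitive[OF _ card_of_image] X(2)])
  moreover have "|{p \<in> Q'. p < q}| \<le>o |UNIV :: omega1 set|" if "q \<in> Q'" for q
  proof -
    have "bounded_in Q {p \<in> Q'. p < q}"
      using s Q'(1) that unfolding bounded_in_def by (auto intro!: bexI[of _ q])
    then have "|{p \<in> Q'. p < q}| <o cardSuc (cardSuc natLeq)"
      using Q(2) unfolding exceeds_bounded_def by blast
    then have "|{p \<in> Q'. p < q}| \<le>o cardSuc natLeq"
      by (rule iffD1[OF cardSuc_ordLeq_ordLess[OF cardSuc_Card_order[OF natLeq_Card_order]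
            card_of_Card_order]])
    then show ?thesis
      by (rule ordLeq_ordIso_trans[OF _ ordIso_symmetric[OF card_of_omega1]])
  qed
  ultimately show ?thesis
    using Q'(2,3) by (intro exI[of _ Q']) simp
qed

section \<open>Coherent codes\<close>

text \<open>An injection of \<open>Q\<close> into \<open>Field lam\<close> pulls the decompositions
  back to finite subsets of \<open>Q\<close>. Cofinality of \<open>\<B>\<close> absorbs a countable
  set together with the image of any prescribed \<open>q\<close>.\<close>

lemma coherent_codes:
  fixes lam :: "'l rel" and Q :: "'q set"
  assumes "Card_order lam" "|Q| \<le>o lam" "coherent_decomposition (Fpow (Field lam))"
  shows "\<exists>(\<B> :: 'l set set) (E :: 'l set \<Rightarrow> nat \<Rightarrow> 'q set).
    (\<forall>B\<in>\<B>. countable B \<and> mono (E B) \<and> (\<forall>n. finite (E B n) \<and> E B n \<subseteq> Q)) \<and>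
    (\<forall>A\<in>\<B>. \<forall>B\<in>\<B>. A \<subseteq> B \<longrightarrow> (\<exists>m. \<forall>n\<ge>m. E A n \<subseteq> E B n)) \<and>
    (\<forall>C q. countable C \<longrightarrow> C \<subseteq> \<Union>\<B> \<longrightarrow> q \<in> Q \<longrightarrow> (\<exists>B\<in>\<B>. C \<subseteq> B \<and> q \<in> (\<Union>n. E B n)))"
proof -
  let ?P = "{A. A \<subseteq> Field lam \<and> countable A}"
  obtain \<B> and D :: "'l set \<Rightarrow> nat \<Rightarrow> 'l set" where cof: "cofinal_in ?P \<B>"
    and D0: "\<forall>B\<in>\<B>. (\<forall>n. D B n \<in> Fpow (Field lam)) \<and> B = (\<Union>n. D B n) \<and>
       (\<forall>n m. n < m \<longrightarrow> D B n \<subseteq> D B m)"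
    and coh: "\<forall>A\<in>\<B>. \<forall>B\<in>\<B>. A \<subset> B \<longrightarrow> (\<exists>m. \<forall>n\<ge>m. D A n \<subseteq> D B n)"
    using assms(3) unfolding coherent_decomposition_def sigma_completion_Fpow
    by (elim exE conjE) (rule that)
  note D = D0[rule_format]
  have "|Q| \<le>o |Field lam|"
    by (rule ordLeq_ordIso_trans[OF assms(2) ordIso_symmetric[OF card_of_Field_ordIso[OF assms(1)]]])
  then obtain g where g: "inj_on g Q" "g ` Q \<subseteq> Field lam"
    unfolding card_of_ordLeq[symmetric] by blast
  define E where "E B n = {q \<in> Q. g q \<in> D B n}" for B n
  show ?thesis
  proof (intro exI[of _ \<B>] exI[of _ E] conjI ballI allI impI)
    show "countable B" if "B \<in> \<B>" for B
      using cof that unfolding cofinal_in_def by blast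
    show "E B n \<subseteq> Q" for B n
      by (auto simp: E_def)
    show "finite (E B n)" if "B \<in> \<B>" for B n
    proof -
      have "finite (D B n)"
        using D[OF that] by (auto simp: Fpow_def)
      moreover have "inj_on g (E B n)"
        using g(1) by (rule inj_on_subset) (auto simp: E_def)
      ultimately show ?thesis
        by (rule inj_on_finite[rotated 2]) (auto simp: E_def)
    qed
    show "mono (E B)" if "B \<in> \<B>" for B
    proof (rule monoI)
      fix n m :: nat
      assume "n \<le> m"
      then have "D B n \<subseteq> D B m"
        using D0 that by (cases "n = m") auto
      then show "E B n \<subseteq> E B m"
        by (auto simp: E_def)
    qed
    show "\<exists>m. \<forall>n\<ge>m. E A n \<subseteq> E B n" if AB: "A \<in> \<B>" "B \<in> \<B>" "A \<subseteq> B" for A B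
    proof (cases "A = B")
      case False
      then obtain m where "\<forall>n\<ge>m. D A n \<subseteq> D B n"
        using coh[rule_format, OF AB(1,2)] AB(3) by blast
      then show ?thesis
        unfolding E_def by blast
    qed auto
    show "\<exists>B\<in>\<B>. C \<subseteq> B \<and> q \<in> (\<Union>n. E B n)" if "countable C" "C \<subseteq> \<Union>\<B>" "q \<in> Q" for C q
    proof -
      have "insert (g q) C \<in> ?P"
        using that g(2) cof unfolding cofinal_in_def by auto
      then obtain B where B: "B \<in> \<B>" "insert (g q) C \<subseteq> B"
        using cof unfolding cofinal_in_def by blast
      then have "g q \<in> (\<Union>n. D B n)"
        using D0 by auto
      then show ?thesis
        using B that(3) by (auto simp: E_def)
    qed
  qed
qed

text \<open>Enumerate \<open>Y\<close> by \<open>omega1\<close> and let stage \<open>\<eta>\<close>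
  absorb all earlier entries, whose union is countable, and the \<open>\<eta>\<close>-th point of
  \<open>Y\<close>.\<close>

lemma omega1_ladder_cover:
  assumes dir: "\<And>C. countable C \<Longrightarrow> C \<subseteq> \<Union>\<B> \<Longrightarrow> \<exists>B\<in>\<B>. C \<subseteq> B \<and> N B"
    and cnt: "\<And>B. B \<in> \<B> \<Longrightarrow> countable B"
    and Y: "Y \<subseteq> \<Union>\<B>" "|Y| \<le>o |UNIV :: omega1 set|"
  shows "\<exists>c :: omega1 \<Rightarrow> 'l set. range c \<subseteq> \<B> \<and> mono c \<and> Y \<subseteq> \<Union>(range c) \<and> (\<forall>d. N (c d))"
proof -
  obtain w :: "omega1 \<Rightarrow> 'l" where w: "Y \<noteq> {} \<Longrightarrow> range w = Y"
    using card_of_ordLeq2[of Y "UNIV :: omega1 set"] Y(2) by blast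
  have "\<exists>B\<in>\<B>. (\<forall>a\<in>A. a \<subseteq> B) \<and> (N B \<and> (Y \<noteq> {} \<longrightarrow> w \<eta> \<in> B))" if "countable A" "A \<subseteq> \<B>" for A \<eta>
  proof -
    \<comment> \<open>\<open>w\<close> enumerates \<open>Y\<close> only when \<open>Y\<close> is
      nonempty; otherwise no point is added.\<close>
    let ?C = "\<Union>A \<union> (if Y = {} then {} else {w \<eta>})"
    have "countable (\<Union>A)"
      using countable_UN[of A "\<lambda>B. B"] that cnt by auto
    then have "countable ?C"
      by simp
    moreover have "?C \<subseteq> \<Union>\<B>"
      using that(2) w Y(1) by auto
    ultimately obtain B where "B \<in> \<B>" "?C \<subseteq> B" "N B"
      using dir by blast
    then show ?thesis
      by (intro bexI[of _ B]) (auto split: if_splits)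
  qed
  then obtain c where c: "\<And>\<eta>. c \<eta> \<in> \<B> \<and> (N (c \<eta>) \<and> (Y \<noteq> {} \<longrightarrow> w \<eta> \<in> c \<eta>)) \<and> (\<forall>\<xi><\<eta>. c \<xi> \<subseteq> c \<eta>)"
    using omega1_sequence[where X = \<B> and R = "(\<subseteq>)"
        and P = "\<lambda>\<eta> B. N B \<and> (Y \<noteq> {} \<longrightarrow> w \<eta> \<in> B)"] by metis
  have "mono c"
    using c by (metis monoI order_le_less subset_refl)
  moreover have "Y \<subseteq> \<Union>(range c)"
    using c w by blast
  ultimately show ?thesis
    using c by blast
qed

text \<open>Recursion along \<open>Q\<close> makes the chain of \<open>q\<close> cover all chains
  below it: at most \<open>\<aleph>\<^sub>1\<close> chains of \<open>\<aleph>\<^sub>1\<close>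
  countable sets, hence at most \<open>\<aleph>\<^sub>1\<close> points. A single countable entry of
  \<open>b p\<close> is then swallowed at some stage of \<open>b q\<close>. The predicate
  \<open>N q\<close> will say that the code contains \<open>q\<close>.\<close>

lemma coherent_ladders:
  fixes Q :: "'p::order set" and N :: "'p \<Rightarrow> 'l set \<Rightarrow> bool"
  assumes wf: "wf {(p, q). p \<in> Q \<and> q \<in> Q \<and> p < q}"
    and small: "\<And>q. q \<in> Q \<Longrightarrow> |{p \<in> Q. p < q}| \<le>o |UNIV :: omega1 set|"
    and cnt: "\<And>B. B \<in> \<B> \<Longrightarrow> countable B"
    and dir: "\<And>C q. countable C \<Longrightarrow> C \<subseteq> \<Union>\<B> \<Longrightarrow> q \<in> Q \<Longrightarrow> \<exists>B\<in>\<B>. C \<subseteq> B \<and> N q B"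
  shows "\<exists>b :: 'p \<Rightarrow> omega1 \<Rightarrow> 'l set. \<forall>q\<in>Q. (\<forall>d. b q d \<in> \<B> \<and> N q (b q d)) \<and>
    (\<forall>p\<in>Q. p \<le> q \<longrightarrow> (\<forall>d. \<exists>d'. \<forall>e\<ge>d'. b p d \<subseteq> b q e))"
proof -
  have "\<exists>b :: 'p \<Rightarrow> omega1 \<Rightarrow> 'l set. \<forall>q. q \<in> Q \<longrightarrow> range (b q) \<subseteq> \<B> \<and> mono (b q) \<and>
     (\<Union>p\<in>{p \<in> Q. p < q}. \<Union>(range (b p))) \<subseteq> \<Union>(range (b q)) \<and> (\<forall>d. N q (b q d))"
  proof (rule dependent_wf_choice[OF wf])
    fix b :: "'p \<Rightarrow> omega1 \<Rightarrow> 'l set" and q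
    assume IH: "\<And>p. (p, q) \<in> {(p, q). p \<in> Q \<and> q \<in> Q \<and> p < q} \<Longrightarrow>
      p \<in> Q \<longrightarrow> range (b p) \<subseteq> \<B> \<and> mono (b p) \<and>
     (\<Union>p\<in>{p' \<in> Q. p' < p}. \<Union>(range (b p))) \<subseteq> \<Union>(range (b p)) \<and> (\<forall>d. N p (b p d))"
    show "\<exists>c :: omega1 \<Rightarrow> 'l set. q \<in> Q \<longrightarrow> range c \<subseteq> \<B> \<and> mono c \<and>
     (\<Union>p\<in>{p \<in> Q. p < q}. \<Union>(range (b p))) \<subseteq> \<Union>(range c) \<and> (\<forall>d. N q (c d))"
    proof (cases "q \<in> Q")
      case True
      let ?Y = "\<Union>p\<in>{p \<in> Q. p < q}. \<Union>(range (b p))"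
      have rng: "range (b p) \<subseteq> \<B>" if "p \<in> {p \<in> Q. p < q}" for p
        using IH[of p] True that by simp
      have inf: "infinite (UNIV :: omega1 set)"
        using uncountable_omega1 countable_finite by blast
      have "|\<Union>(range (b p))| \<le>o |UNIV :: omega1 set|" if "p \<in> {p \<in> Q. p < q}" for p
      proof -
        have "|b p d| \<le>o |UNIV :: omega1 set|" for d
          using rng[OF that] cnt by (intro countable_ordLeq_omega1) blast
        then show ?thesis
          by (intro card_of_UNION_ordLeq_infinite[OF inf card_of_mono1[OF subset_UNIV]] ballI)
      qed
      then have "|?Y| \<le>o |UNIV :: omega1 set|"
        by (intro card_of_UNION_ordLeq_infinite[OF inf small[OF True]]) auto
      moreover have "?Y \<subseteq> \<Union>\<B>"
        using rng by blast
      ultimately have "\<exists>c :: omega1 \<Rightarrow> 'l set. range c \<subseteq> \<B> \<and> mono c \<and> ?Y \<subseteq> \<Union>(range c) \<and>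
          (\<forall>d. N q (c d))"
        by (intro omega1_ladder_cover[OF dir[OF _ _ True] cnt])
      then show ?thesis
        using True by simp
    qed simp
  next
    \<comment> \<open>The recursion is legitimate because its condition at \<open>q\<close> consults
      the earlier chains only at members of \<open>Q\<close> strictly below
      \<open>q\<close>.\<close>
    fix b c :: "'p \<Rightarrow> omega1 \<Rightarrow> 'l set" and q v
    assume eq: "\<And>p. (p, q) \<in> {(p, q). p \<in> Q \<and> q \<in> Q \<and> p < q} \<Longrightarrow> b p = c p"
    have "(\<Union>p\<in>{p \<in> Q. p < q}. \<Union>(range (b p))) = (\<Union>p\<in>{p \<in> Q. p < q}. \<Union>(range (c p)))"
      if "q \<in> Q"
      by (intro SUP_cong refl) (simp add: eq that)
    then show "(q \<in> Q \<longrightarrow> range v \<subseteq> \<B> \<and> mono v \<and>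
        (\<Union>p\<in>{p \<in> Q. p < q}. \<Union>(range (b p))) \<subseteq> \<Union>(range v) \<and> (\<forall>d. N q (v d))) =
      (q \<in> Q \<longrightarrow> range v \<subseteq> \<B> \<and> mono v \<and>
        (\<Union>p\<in>{p \<in> Q. p < q}. \<Union>(range (c p))) \<subseteq> \<Union>(range v) \<and> (\<forall>d. N q (v d)))"
      by (cases "q \<in> Q") simp_all
  qed
  then obtain b :: "'p \<Rightarrow> omega1 \<Rightarrow> 'l set" where
    b: "\<And>q. q \<in> Q \<Longrightarrow> range (b q) \<subseteq> \<B> \<and> mono (b q) \<and>
     (\<Union>p\<in>{p \<in> Q. p < q}. \<Union>(range (b p))) \<subseteq> \<Union>(range (b q)) \<and> (\<forall>d. N q (b q d))"
    by blast
  have "\<exists>d'. \<forall>e\<ge>d'. b p d \<subseteq> b q e" if "p \<in> Q" "q \<in> Q" "p \<le> q" for p q d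
  proof (cases "p = q")
    case True
    then show ?thesis
      using b[OF \<open>q \<in> Q\<close>] by (intro exI[of _ d]) (simp add: monoD)
  next
    case False
    then have "p \<in> {p \<in> Q. p < q}"
      using that by simp
    then have "b p d \<subseteq> (\<Union>p\<in>{p \<in> Q. p < q}. \<Union>(range (b p)))"
      by blast
    then have "b p d \<subseteq> \<Union>(range (b q))"
      using b[OF \<open>q \<in> Q\<close>] by (meson order_trans)
    then have "\<forall>x\<in>b p d. \<exists>e. x \<in> b q e"
      by blast
    then obtain e where e: "\<And>x. x \<in> b p d \<Longrightarrow> x \<in> b q (e x)"
      by metis
    have "b p d \<in> \<B>"
      using b[OF \<open>p \<in> Q\<close>] by auto
    then have "countable (b p d)"
      by (rule cnt)
    \<comment> \<open>Regularity bounds the countably many stages at which the points of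
      \<open>b p d\<close> enter the chain of \<open>q\<close>.\<close>
    then obtain d' where "\<forall>a\<in>e ` b p d. a < d'"
      using countable_omega1_bounded[of "e ` b p d"] by auto
    then have "e x < d'" if "x \<in> b p d" for x
      using that by simp
    then have "x \<in> b q u" if "d' \<le> u" "x \<in> b p d" for u x
      using e[OF that(2)] that monoD[of "b q" "e x" u] b[OF \<open>q \<in> Q\<close>] less_imp_le[of "e x" u]
        less_le_trans[of "e x" d' u] by auto
    then show ?thesis by blast
  qed
  moreover have "b q d \<in> \<B> \<and> N q (b q d)" if "q \<in> Q" for q d
    using b[OF that] by auto
  ultimately show ?thesis
    by (intro exI[of _ b]) simp
qed

section \<open>TWO's winning responses\<close>

lemma free_ideal_finite_Union:
  assumes "free_ideal S J" "finite \<C>" "\<C> \<subseteq> J"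
  shows "\<Union>\<C> \<in> J"
  using assms(2,3)
proof (induction rule: finite_induct)
  case empty
  then show ?case using assms(1) by (simp add: free_ideal_def)
next
  case (insert A \<C>)
  then have "A \<in> J" "\<Union>\<C> \<in> J" by auto
  then have "A \<union> \<Union>\<C> \<in> J"
    using assms(1) unfolding free_ideal_def by blast
  then show ?case by simp
qed

lemma sigma_completion_decomposition:
  assumes "free_ideal S J" "A \<in> sigma_completion J"
  shows "\<exists>D :: nat \<Rightarrow> 'a set. range D \<subseteq> J \<and> mono D \<and> A = (\<Union>n. D n)"
proof -
  obtain \<C> where \<C>: "countable \<C>" "\<C> \<subseteq> J" "A = \<Union>\<C>"
    using assms(2) unfolding sigma_completion_def by blast
  \<comment> \<open>The added empty set makes the family nonempty, so that
    \<open>from_nat_into\<close> enumerates exactly it.\<close>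
  define \<C>' where "\<C>' = insert {} \<C>"
  have \<C>': "\<C>' \<subseteq> J" "A = \<Union>\<C>'"
    using \<C> assms(1) unfolding \<C>'_def free_ideal_def by auto
  have rng: "range (from_nat_into \<C>') = \<C>'"
    using \<C>(1) by (intro range_from_nat_into) (auto simp: \<C>'_def)
  define D where "D n = \<Union>(from_nat_into \<C>' ` {..n})" for n
  have "from_nat_into \<C>' ` {..n} \<subseteq> J" for n
    using rng \<C>'(1) by blast
  then have "D n \<in> J" for n
    unfolding D_def by (intro free_ideal_finite_Union[OF assms(1)]) auto
  moreover have "mono D"
    unfolding D_def by (intro monoI) (auto intro: order_trans)
  moreover have "A = (\<Union>n. D n)"
  proof -
    have "A = \<Union>(range (from_nat_into \<C>'))"
      using rng \<C>'(2) by simp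
    also have "\<dots> = (\<Union>n. D n)"
      unfolding D_def by auto
    finally show ?thesis .
  qed
  ultimately show ?thesis by blast
qed

lemma sigma_completion_Union:
  assumes "countable \<A>" "\<A> \<subseteq> sigma_completion J"
  shows "\<Union>\<A> \<in> sigma_completion J"
proof -
  have "\<forall>A\<in>\<A>. \<exists>\<C>. countable \<C> \<and> \<C> \<subseteq> J \<and> \<Union>\<C> = A"
  proof
    fix A assume "A \<in> \<A>"
    then have "A \<in> sigma_completion J"
      using assms(2) by blast
    then show "\<exists>\<C>. countable \<C> \<and> \<C> \<subseteq> J \<and> \<Union>\<C> = A"
      unfolding sigma_completion_def by auto
  qed
  from bchoice[OF this] obtain c where
    c: "\<forall>A\<in>\<A>. countable (c A) \<and> c A \<subseteq> J \<and> \<Union>(c A) = A"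
    by (rule exE)
  have "\<Union>(\<Union>(c ` \<A>)) = (\<Union>A\<in>\<A>. \<Union>(c A))"
    by blast
  also have "\<dots> = \<Union>\<A>"
    using c by simp
  finally have "\<Union>\<A> = \<Union>(\<Union>(c ` \<A>))"
    by (rule sym)
  moreover have "countable (\<Union>(c ` \<A>))"
    using assms(1) c by (intro countable_UN) auto
  moreover have "\<Union>(c ` \<A>) \<subseteq> J"
    using c by auto
  ultimately show ?thesis
    unfolding sigma_completion_def by (intro CollectI exI[of _ "\<Union>(c ` \<A>)"]) simp
qed

text \<open>An unbounded set attaining the additivity has size \<open>\<aleph>\<^sub>1\<close>, so
  \<open>omega1\<close> enumerates it; it is nonempty because the empty set is bounded in a nonempty
  poset.\<close>

lemma unbounded_omega1_sequence:
  fixes P :: "'p::order set"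
  assumes "is_add P (cardSuc natLeq)" "P \<noteq> {}"
  shows "\<exists>G :: omega1 \<Rightarrow> 'p. range G \<subseteq> P \<and> (\<forall>p\<in>P. \<exists>\<xi>. \<not> G \<xi> \<le> p)"
proof -
  obtain X where X: "X \<subseteq> P" "\<not> bounded_in P X" "|X| =o cardSuc natLeq"
    using assms(1) unfolding is_add_def least_cardinality_def by blast
  have "X \<noteq> {}"
    using X(1,2) assms(2) by (auto simp: bounded_in_def)
  moreover have "|X| \<le>o |UNIV :: omega1 set|"
    by (rule ordIso_imp_ordLeq[OF ordIso_transitive[OF X(3) ordIso_symmetric[OF card_of_omega1]]])
  ultimately obtain G :: "omega1 \<Rightarrow> 'p" where G: "range G = X"
    using card_of_ordLeq2[of X "UNIV :: omega1 set"] by auto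
  have "\<exists>\<xi>. \<not> G \<xi> \<le> p" if "p \<in> P" for p
  proof (rule ccontr)
    assume "\<nexists>\<xi>. \<not> G \<xi> \<le> p"
    then have "\<forall>x\<in>X. x \<le> p"
      unfolding G[symmetric] by simp
    then show False
      using X(1,2) that by (auto simp: bounded_in_def)
  qed
  then show ?thesis
    using G X(1) by (intro exI[of _ G]) simp
qed

text \<open>Take the first \<open>n\<close> from \<open>m\<close> on at which \<open>k n\<close> is
  large enough for both \<open>q m\<close> and \<open>x\<close>. Each threshold between
  \<open>m\<close> and \<open>n\<close> is at most \<open>k n\<close>, so coherence carries
  \<open>q m\<close> at index \<open>k n\<close> from \<open>E m\<close> up to
  \<open>E (Suc n)\<close>.\<close>

lemma coherent_path_covers:
  fixes E :: "nat \<Rightarrow> nat \<Rightarrow> 'q set" and D :: "'q \<Rightarrow> nat \<Rightarrow> 'a set"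
  assumes E: "\<And>n. mono (E n)" and D: "\<And>n. mono (D (q n))"
    and q: "\<And>n. q n \<in> (\<Union>k. E n k)"
    and coh: "\<And>n j. k n \<le> j \<Longrightarrow> E n j \<subseteq> E (Suc n) j"
    and unb: "\<And>m N. \<exists>n\<ge>m. N \<le> k n"
    and x: "x \<in> (\<Union>j. D (q m) j)"
  shows "\<exists>n. x \<in> (\<Union>p\<in>E (Suc n) (k n). D p (k n))"
proof -
  obtain i j where ij: "q m \<in> E m i" "x \<in> D (q m) j"
    using q[of m] x by blast
  define N where "N = max i j"
  define n where "n = (LEAST n. m \<le> n \<and> N \<le> k n)"
  have n: "m \<le> n" "N \<le> k n"
    using LeastI_ex[of "\<lambda>n. m \<le> n \<and> N \<le> k n", OF unb[of m N]] unfolding n_def by simp_all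
  have small: "k l \<le> k n" if "m \<le> l" "l \<le> n" for l
  proof (cases "l = n")
    case False
    then have "l < n" using that by simp
    then have "\<not> N \<le> k l"
      using not_less_Least[of l "\<lambda>n. m \<le> n \<and> N \<le> k n"] that(1) unfolding n_def by simp
    then show ?thesis using n(2) by simp
  qed simp
  have "q m \<in> E l (k n)" if "m \<le> l" "l \<le> Suc n" for l
    using that
  proof (induction rule: dec_induct)
    case base
    have "i \<le> k n" using n(2) by (simp add: N_def)
    then show ?case
      using monoD[OF E[of m], of i "k n"] ij(1) by auto
  next
    case (step l)
    then have "k l \<le> k n"
      using small[of l] by simp
    then show ?case
      using coh[of l "k n"] step by auto
  qed
  then have "q m \<in> E (Suc n) (k n)"
    using n(1) by simp
  moreover have "j \<le> k n" using n(2) by (simp add: N_def)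
  then have "x \<in> D (q m) (k n)"
    using monoD[OF D[of m], of j "k n"] ij(2) by auto
  ultimately show ?thesis by blast
qed

theorem theorem34:
  fixes S :: "'a set" and J :: "'a set set" and lam :: "'l rel"
  assumes "free_ideal S J"
    and "S \<notin> sigma_completion J"
    and "Card_order lam"
    and "is_bu (sigma_completion J) (cardSuc (cardSuc natLeq))"
    and "is_add (sigma_completion J) (cardSuc natLeq)"
    and "is_cof (sigma_completion J) lam"
    and "coherent_decomposition (Fpow (Field lam))"
  shows "\<exists>F. VSG_winning_tactic_TWO J 3 F"
proof -

  \<comment> \<open>Cofinal family, codes, decompositions and ordinals\<close>
  let ?P = "sigma_completion J"
  obtain Q where Q: "cofinal_in ?P Q" "|Q| \<le>o lam" "wf {(p, q). p \<in> Q \<and> q \<in> Q \<and> p < q}"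
    "\<And>q. q \<in> Q \<Longrightarrow> |{p \<in> Q. p < q}| \<le>o |UNIV :: omega1 set|"
    using thin_cofinal_subset[OF assms(4,6)] by blast
  have QP: "Q \<subseteq> ?P"
    using Q(1) unfolding cofinal_in_def by blast
  from coherent_codes[OF assms(3) Q(2) assms(7)]
  obtain \<B> :: "'l set set" and E :: "'l set \<Rightarrow> nat \<Rightarrow> 'a set set" where
    E: "\<forall>B\<in>\<B>. countable B \<and> mono (E B) \<and> (\<forall>n. finite (E B n) \<and> E B n \<subseteq> Q)"
    and Ecoh: "\<forall>A\<in>\<B>. \<forall>B\<in>\<B>. A \<subseteq> B \<longrightarrow> (\<exists>m. \<forall>n\<ge>m. E A n \<subseteq> E B n)"
    and Edir: "\<forall>C q. countable C \<longrightarrow> C \<subseteq> \<Union>\<B> \<longrightarrow> q \<in> Q \<longrightarrow> (\<exists>B\<in>\<B>. C \<subseteq> B \<and> q \<in> (\<Union>n. E B n))"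
    by (elim exE conjE) (rule that)
  have Emono: "mono (E B)" if "B \<in> \<B>" for B
    using E that by simp
  have "\<exists>b :: 'a set \<Rightarrow> omega1 \<Rightarrow> 'l set. \<forall>q\<in>Q.
      (\<forall>d. b q d \<in> \<B> \<and> q \<in> (\<Union>n. E (b q d) n)) \<and>
      (\<forall>p\<in>Q. p \<subseteq> q \<longrightarrow> (\<forall>d. \<exists>d'. \<forall>e\<ge>d'. b p d \<subseteq> b q e))"
    using E by (intro coherent_ladders[OF Q(3,4) _ Edir[rule_format]]) simp_all
  then obtain b :: "'a set \<Rightarrow> omega1 \<Rightarrow> 'l set" where
    b0: "\<forall>q\<in>Q. (\<forall>d. b q d \<in> \<B> \<and> q \<in> (\<Union>n. E (b q d) n)) \<and>
      (\<forall>p\<in>Q. p \<subseteq> q \<longrightarrow> (\<forall>d. \<exists>d'. \<forall>e\<ge>d'. b p d \<subseteq> b q e))"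
    by (rule exE)
  have b: "b q d \<in> \<B>" "q \<in> (\<Union>n. E (b q d) n)" if "q \<in> Q" for q d
    using bspec[OF b0 that] by simp_all
  have b_lim: "\<exists>d'. \<forall>e\<ge>d'. b p d \<subseteq> b q e" if "p \<in> Q" "q \<in> Q" "p \<subseteq> q" for p q d
    using bspec[OF b0 that(2)] that(1,3) by simp
  have "\<forall>q\<in>Q. \<exists>D :: nat \<Rightarrow> 'a set. range D \<subseteq> J \<and> mono D \<and> (\<Union>n. D n) = q"
  proof
    fix q assume "q \<in> Q"
    then have "q \<in> ?P"
      using QP by blast
    from sigma_completion_decomposition[OF assms(1) this]
    obtain D :: "nat \<Rightarrow> 'a set" where "range D \<subseteq> J \<and> mono D \<and> q = (\<Union>n. D n)"
      by (rule exE)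
    then show "\<exists>D :: nat \<Rightarrow> 'a set. range D \<subseteq> J \<and> mono D \<and> (\<Union>n. D n) = q"
      by (intro exI[of _ D]) simp
  qed
  from bchoice[OF this] obtain D :: "'a set \<Rightarrow> nat \<Rightarrow> 'a set" where
    D0: "\<forall>q\<in>Q. range (D q) \<subseteq> J \<and> mono (D q) \<and> (\<Union>n. D q n) = q"
    by (rule exE)
  have D: "D q n \<in> J" "mono (D q)" "(\<Union>n. D q n) = q" if "q \<in> Q" for q n
    using bspec[OF D0 that] by auto
  have "{} \<in> ?P"
    using sigma_completion_Union[of "{}" J] by simp
  then have "?P \<noteq> {}"
    by blast
  from unbounded_omega1_sequence[OF assms(5) this] obtain G :: "omega1 \<Rightarrow> 'a set" where
    G0: "range G \<subseteq> ?P \<and> (\<forall>p\<in>?P. \<exists>\<xi>. \<not> G \<xi> \<subseteq> p)"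
    by (rule exE)
  have G: "G \<xi> \<in> ?P" "p \<in> ?P \<Longrightarrow> \<exists>\<xi>. \<not> G \<xi> \<subseteq> p" for \<xi> p
    using G0 by auto
  from omega1_path_colouring obtain h :: "omega1 \<Rightarrow> omega1 \<Rightarrow> nat" where
    h0: "\<forall>x :: nat \<Rightarrow> omega1. (\<forall>n. x n < x (Suc n)) \<longrightarrow> (\<forall>N. \<exists>n. N \<le> h (x n) (x (Suc n)))"
    by (rule exE)
  note h = h0[rule_format]
  have "\<forall>X\<in>?P. \<exists>q. q \<in> Q \<and> X \<subseteq> q"
    using Q(1) unfolding cofinal_in_def by blast
  from bchoice[OF this] obtain a where a0: "\<forall>X\<in>?P. a X \<in> Q \<and> X \<subseteq> a X"
    by (rule exE)
  have a: "a X \<in> Q" "X \<subseteq> a X" if "X \<in> ?P" for X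
    using a0 that by simp_all

  \<comment> \<open>TWO's responses\<close>
  define \<rho> where "\<rho> X = (LEAST \<xi>. \<not> G \<xi> \<subseteq> X)" for X
  \<comment> \<open>A stage from which the chain of \<open>a Y\<close> includes the code of
    \<open>X\<close> and \<open>Y\<close>; it is known before ONE's next move fixes the next
    code.\<close>
  define lim where "lim X Y = (SOME d. \<forall>e\<ge>d. b (a X) (\<rho> Y) \<subseteq> b (a Y) e)" for X Y
  define thr where "thr A B = (LEAST m. \<forall>n\<ge>m. E A n \<subseteq> E B n)" for A B
  define code where "code X Y = b (a X) (\<rho> Y)" for X Y
  \<comment> \<open>A code takes two successive moves, so comparing two successive codes takes
    three.\<close>
  define \<kappa> where "\<kappa> X Y Z = max (thr (code X Y) (code Y Z)) (h (\<rho> Y) (\<rho> Z))" for X Y Z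
  define T where "T X Y Z = (\<Union>p\<in>E (code Y Z) (\<kappa> X Y Z). D p (\<kappa> X Y Z))" for X Y Z
  \<comment> \<open>Including \<open>\<rho> X\<close> in the maximum makes the ordinals of ONE's
    moves increase strictly, whatever \<open>d\<close> is.\<close>
  define U where "U d X = a X \<union> \<Union>(G ` {..max d (\<rho> X)})" for d X
  \<comment> \<open>In the first two innings the first component may be empty, since coverage is
    secured later. With a single move there is no code yet, and \<open>\<rho> X\<close> is a default
    for \<open>d\<close>.\<close>
  define F where "F xs = (case xs of [X] \<Rightarrow> ({}, U (\<rho> X) X) | [X, Y] \<Rightarrow> ({}, U (lim X Y) Y)
      | [X, Y, Z] \<Rightarrow> (T X Y Z, U (lim Y Z) Z) | _ \<Rightarrow> ({}, {}))" for xs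

  \<comment> \<open>Raising ordinals and legality of the responses\<close>
  have below_\<rho>: "d < \<rho> X" if "X \<in> ?P" "\<Union>(G ` {..d}) \<subseteq> X" for d X
  proof (rule ccontr)
    assume "\<not> d < \<rho> X"
    then have "G (\<rho> X) \<subseteq> \<Union>(G ` {..d})"
      by (intro UN_upper) simp
    then have "G (\<rho> X) \<subseteq> X"
      using that(2) by (rule order_trans)
    then show False
      using LeastI_ex[OF G(2)[OF that(1)]] unfolding \<rho>_def by simp
  qed
  have U: "U d X \<in> ?P" if "X \<in> ?P" for d X
  proof -
    have "\<Union>(insert (a X) (G ` {..max d (\<rho> X)})) \<in> ?P"
      using a(1)[OF that] QP G(1) countable_atMost_omega1 by (intro sigma_completion_Union) auto
    then show ?thesis unfolding U_def by simp
  qed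
  have T: "T X Y Z \<in> J" if "Y \<in> ?P" for X Y Z
  proof -
    have "code Y Z \<in> \<B>"
      unfolding code_def by (rule b(1)[OF a(1)[OF that]])
    then have "finite (E (code Y Z) (\<kappa> X Y Z))" "E (code Y Z) (\<kappa> X Y Z) \<subseteq> Q"
      using E by simp_all
    then show ?thesis
      unfolding T_def using D(1) by (intro free_ideal_finite_Union[OF assms(1)]) auto
  qed
  have "{} \<in> J"
    using assms(1) by (simp add: free_ideal_def)
  then have "VSG_tactic_TWO J 3 F"
    unfolding VSG_tactic_TWO_def F_def using U T by (auto split: list.split)

  \<comment> \<open>A play in which TWO follows \<open>F\<close>\<close>
  moreover have "VSG_TWO_wins Om T'" if play: "VSG_play J Om T' U'" and fol: "VSG_follows 3 F Om T' U'"
    for Om T' U'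
  proof -
    have Om: "Om n \<in> ?P" "T' n \<subseteq> Om (Suc n)" "U' n \<subseteq> Om (Suc n)" "Om n \<subseteq> Om (Suc n)" for n
      using play unfolding VSG_play_def by auto
    have upt3: "[Suc n..<Suc (n + 3)] = [Suc n, Suc (Suc n), Suc (Suc (Suc n))]" for n
      by (simp add: upt_rec)
    have fol0: "(T' 0, U' 0) = F [Om 0]" "(T' 1, U' 1) = F [Om 0, Om 1]"
      "(T' 2, U' 2) = F [Om 0, Om 1, Om 2]"
      using fol unfolding VSG_follows_def by (auto simp: upt_rec numeral_2_eq_2 dest!: spec[of _ 0])
    have fol3: "(T' (n + 3), U' (n + 3)) = F [Om (Suc n), Om (Suc (Suc n)), Om (Suc (Suc (Suc n)))]" for n
      using fol unfolding VSG_follows_def upt3 by simp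
    have T': "T' (Suc (Suc n)) = T (Om n) (Om (Suc n)) (Om (Suc (Suc n)))" for n
      using fol0(3) fol3[of "n - 1"] by (cases n) (auto simp: F_def eval_nat_numeral)
    \<comment> \<open>The second component depends on the last two moves only, so one formula serves
      lists of length two and three.\<close>
    have U'S: "U' (Suc n) = U (lim (Om n) (Om (Suc n))) (Om (Suc n))" for n
      using fol0(2,3) fol3[of "n - 2"]
      by (cases n; cases "n - 1") (auto simp: F_def eval_nat_numeral)
    have U'0: "U' 0 = U (\<rho> (Om 0)) (Om 0)"
      using fol0(1) by (auto simp: F_def)
    have Un: "\<exists>d. U' n = U d (Om n)" for n
      using U'S U'0 by (cases n) auto
    have aOm: "a (Om n) \<subseteq> Om (Suc n)" for n
      using Un[of n] Om(3)[of n] unfolding U_def by auto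
    have U_ge: "\<Union>(G ` {..e}) \<subseteq> U d X" if "e \<le> max d (\<rho> X)" for d e X
      using that order_trans unfolding U_def by auto
    have "\<Union>(G ` {..\<rho> (Om n)}) \<subseteq> Om (Suc n)" for n
    proof -
      obtain d where "U' n = U d (Om n)"
        using Un[of n] by (rule exE)
      moreover have "\<Union>(G ` {..\<rho> (Om n)}) \<subseteq> U d (Om n)"
        by (rule U_ge) simp
      ultimately show ?thesis
        using Om(3)[of n] by simp
    qed
    then have incr: "\<rho> (Om n) < \<rho> (Om (Suc n))" for n
      by (intro below_\<rho> Om(1))
    \<comment> \<open>TWO's answer to \<open>Om (Suc n)\<close> pushes the ordinal of the next move
      beyond \<open>lim\<close>, where the chain of \<open>a (Om (Suc n))\<close> includes the
      previous code.\<close>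
    have sub: "code (Om n) (Om (Suc n)) \<subseteq> code (Om (Suc n)) (Om (Suc (Suc n)))" for n
    proof -
      have "a (Om n) \<subseteq> a (Om (Suc n))"
        using aOm[of n] a(2)[OF Om(1)[of "Suc n"]] by (rule order_trans)
      then have "\<exists>d. \<forall>e\<ge>d. b (a (Om n)) (\<rho> (Om (Suc n))) \<subseteq> b (a (Om (Suc n))) e"
        by (intro b_lim a(1) Om(1))
      then have "\<forall>e\<ge>lim (Om n) (Om (Suc n)). b (a (Om n)) (\<rho> (Om (Suc n))) \<subseteq> b (a (Om (Suc n))) e"
        unfolding lim_def by (rule someI_ex)
      moreover have "\<Union>(G ` {..lim (Om n) (Om (Suc n))}) \<subseteq> Om (Suc (Suc n))"
        using U_ge[OF max.cobounded1] Om(3)[of "Suc n"] unfolding U'S by (rule order_trans)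
      then have "lim (Om n) (Om (Suc n)) < \<rho> (Om (Suc (Suc n)))"
        by (intro below_\<rho> Om(1))
      ultimately show ?thesis
        unfolding code_def by simp
    qed
    have code: "code (Om n) (Om (Suc n)) \<in> \<B>" "a (Om n) \<in> (\<Union>k. E (code (Om n) (Om (Suc n))) k)" for n
      unfolding code_def by (rule b[OF a(1)[OF Om(1)]])+
    \<comment> \<open>The index of the pieces that TWO plays in answer to
      \<open>Om (Suc (Suc n))\<close>.\<close>
    define k where "k n = \<kappa> (Om n) (Om (Suc n)) (Om (Suc (Suc n)))" for n
    have coh: "E (code (Om n) (Om (Suc n))) j \<subseteq> E (code (Om (Suc n)) (Om (Suc (Suc n)))) j"
      if "k n \<le> j" for n j
    proof -
      let ?A = "code (Om n) (Om (Suc n))" and ?B = "code (Om (Suc n)) (Om (Suc (Suc n)))"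
      have "\<exists>m. \<forall>j\<ge>m. E ?A j \<subseteq> E ?B j"
        using bspec[OF bspec[OF Ecoh code(1)[of n]] code(1)[of "Suc n"]] sub[of n] by (rule mp)
      then have "\<forall>j\<ge>thr ?A ?B. E ?A j \<subseteq> E ?B j"
        unfolding thr_def by (rule LeastI_ex)
      moreover have "thr ?A ?B \<le> j"
        using that unfolding k_def \<kappa>_def by simp
      ultimately show ?thesis
        by simp
    qed
    \<comment> \<open>The colouring property is applied to the path of ordinals that starts at
      \<open>Om (Suc m)\<close>.\<close>
    have unb: "\<exists>n\<ge>m. N \<le> k n" for m N
    proof -
      obtain n where "N \<le> h (\<rho> (Om (Suc (m + n)))) (\<rho> (Om (Suc (m + Suc n))))"
        using h[of "\<lambda>n. \<rho> (Om (Suc (m + n)))" N] incr by auto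
      then have "N \<le> k (m + n)"
        unfolding k_def \<kappa>_def by simp
      then show ?thesis
        by (intro exI[of _ "m + n"]) simp
    qed
    have Em: "mono (E (code (Om n) (Om (Suc n))))" for n
      by (rule Emono[OF code(1)])
    have Dm: "mono (D (a (Om n)))" for n
      by (rule D(2)[OF a(1)[OF Om(1)]])
    have "x \<in> (\<Union>n. T' n)" if "x \<in> Om m" for x m
    proof -
      have "x \<in> (\<Union>j. D (a (Om m)) j)"
        using D(3)[OF a(1)[OF Om(1)[of m]]] a(2)[OF Om(1)[of m]] that by blast
      with Em Dm code(2) coh unb
      have "\<exists>n. x \<in> (\<Union>p\<in>E (code (Om (Suc n)) (Om (Suc (Suc n)))) (k n). D p (k n))"
        by (rule coherent_path_covers[where E = "\<lambda>n. E (code (Om n) (Om (Suc n)))"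
              and q = "\<lambda>n. a (Om n)"])
      then obtain n where "x \<in> (\<Union>p\<in>E (code (Om (Suc n)) (Om (Suc (Suc n)))) (k n). D p (k n))"
        by (rule exE)
      then have "x \<in> T' (Suc (Suc n))"
        unfolding T' T_def k_def .
      then show ?thesis by blast
    qed
    \<comment> \<open>The converse inclusion is a rule of the game: ONE's next move includes each
      set played by TWO.\<close>
    then show ?thesis
      unfolding VSG_TWO_wins_def using Om(2) by blast
  qed
  ultimately show ?thesis
    unfolding VSG_winning_tactic_TWO_def by blast
qed

end
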